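(* Let $A,B\in\mathbb{R}$ be fixed. For $N>0$ put $$Z(A,B,N)=e^{-N}\sum_{n=0}^\infty\frac{N^n}{n!}\exp\biggl\{i\biggl(\frac{An}{\sqrt N}+\frac{Bn^2}{2\sqrt{N^3}}\biggr)\biggr\}.$$ Then, as $N\to\infty$, $$Z(A,B,N)=\frac{e^{i\sqrt{N}(A+B/2)}}{\sqrt{1-iB/\sqrt{N}}}\;e^{-\frac{(A+B)^2}{2(1-iB/\sqrt{N})}}\biggl(1-i\,\frac{(A+B)^3}{6\sqrt{N}}\biggr)+O(N^{-1}).$$
   Context: The square root of a complex number with positive real part is the principal one. Convention on error terms: powers of $\log N$ are treated as bounded quantities, so that for example $\log N/N=O(N^{-1})$. Thus, with $A,B$ fixed, "$O(N^{-1})$" means that there are constants $C>0$, $k\ge 0$ and $N_0$ such that the absolute value of the error is at most $C(\log N)^k N^{-1}$ for all $N\ge N_0$. *)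

theory Defs
  imports "HOL-Analysis.Analysis"
begin

definition Z :: "real \<Rightarrow> real \<Rightarrow> real \<Rightarrow> complex" where
  "Z A B N = exp (- of_real N) *
     (\<Sum>n. of_real (N ^ n / fact n) *
        exp (\<i> * of_real (A * real n / sqrt N + B * (real n)\<^sup>2 / (2 * sqrt (N ^ 3)))))"

text \<open>\<open>csqrt\<close> is the principal branch of the square root; here its argument has real part \<open>1\<close>.\<close>

definition Z_approx :: "real \<Rightarrow> real \<Rightarrow> real \<Rightarrow> complex" where
  "Z_approx A B N =
     exp (\<i> * of_real (sqrt N * (A + B / 2))) / csqrt (1 - \<i> * of_real (B / sqrt N)) *
     exp (- (of_real ((A + B)\<^sup>2) / (2 * (1 - \<i> * of_real (B / sqrt N))))) *
     (1 - \<i> * of_real ((A + B) ^ 3 / (6 * sqrt N)))"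

text \<open>
  \<open>big_O_mod_log E g\<close> says that \<open>E N = O(g N)\<close> as \<open>N \<rightarrow> \<infinity>\<close>, where powers of \<open>ln N\<close> are
  treated as bounded. Restricting the exponent \<open>k\<close> to natural numbers loses nothing: a real
  exponent can be rounded up once \<open>ln N \<ge> 1\<close>.
\<close>

definition big_O_mod_log :: "(real \<Rightarrow> complex) \<Rightarrow> (real \<Rightarrow> real) \<Rightarrow> bool" where
  "big_O_mod_log E g \<longleftrightarrow>
     (\<exists>C>0. \<exists>k::nat. \<exists>N0>0. \<forall>N\<ge>N0. norm (E N) \<le> C * ln N ^ k * g N)"

end

theory Submission
  imports Defs "HOL-Library.Landau_Symbols"
begin

text \<open>
  With \<open>x = (n - N) / sqrt N\<close> the phase is \<open>sqrt N * (A + B / 2) + t * x + s * x\<^sup>2 / 2\<close>, where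
  \<open>t = A + B\<close> and \<open>s = B / sqrt N\<close>. As \<open>s\<^sup>2 = O(1 / N)\<close> and the fourth Poisson moment of \<open>x\<close> is
  bounded, the factor \<open>exp (\<i> * s * x\<^sup>2 / 2)\<close> can be replaced by \<open>1 + \<i> * s * x\<^sup>2 / 2\<close>. The
  resulting Poisson sums are elementary, and it remains to compare two expansions of the form
  \<open>p + q / sqrt N + O(1 / N)\<close>.
\<close>

section \<open>Calculus of first-order expansions in \<open>1 / sqrt N\<close>\<close>

text \<open>The coefficients \<open>p\<close> and \<open>q\<close> are independent of
  \<open>N\<close>, so two functions that expand with the same pair differ by O(1/N); this is how
  the two sides are compared in the end. The comparison function is embedded into the complex
  numbers because Landau symbols relate functions with values in one field.\<close>

definition expands :: "(real \<Rightarrow> complex) \<Rightarrow> complex \<Rightarrow> complex \<Rightarrow> bool" where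
  "expands f p q \<longleftrightarrow>
     (\<lambda>N. f N - (p + q * of_real (1 / sqrt N))) \<in> O[at_top](\<lambda>N. of_real (1 / N))"

lemma bigo_inverse_sqrt_mult:
  fixes f g :: "real \<Rightarrow> complex"
  assumes "f \<in> O(\<lambda>N. of_real (1 / sqrt N))" "g \<in> O(\<lambda>N. of_real (1 / sqrt N))"
  shows "(\<lambda>N. f N * g N) \<in> O(\<lambda>N. of_real (1 / N))"
proof -
  have "(\<lambda>N. f N * g N) \<in> O(\<lambda>N. of_real (1 / sqrt N) * of_real (1 / sqrt N))"
    using assms by (rule landau_o.big.mult)
  also have "eventually (\<lambda>N. of_real (1 / sqrt N) * of_real (1 / sqrt N)
      = (of_real (1 / N) :: complex)) at_top"
    using eventually_gt_at_top[of 0]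
    by eventually_elim (simp flip: of_real_mult)
  then have "O(\<lambda>N. of_real (1 / sqrt N) * of_real (1 / sqrt N))
      = O[at_top](\<lambda>N. of_real (1 / N) :: complex)"
    by (rule landau_o.big.cong)
  finally show ?thesis .
qed

lemma inverse_sqrt_bigo_1: "(\<lambda>N. of_real (1 / sqrt N) :: complex) \<in> O[at_top](\<lambda>_. 1)"
  by (rule bigoI[where c = 1], use eventually_ge_at_top[of 1] in eventually_elim)
    (simp add: norm_divide)

lemma cmult_inverse_sqrt_bigo:
  "(\<lambda>N. q * of_real (1 / sqrt N) :: complex) \<in> O[at_top](\<lambda>N. of_real (1 / sqrt N))"
  by (rule bigoI[where c = "norm q"]) (simp only: norm_mult order.refl eventually_True)

lemma inverse_bigo_inverse_sqrt:
  "(\<lambda>N. of_real (1 / N) :: complex) \<in> O[at_top](\<lambda>N. of_real (1 / sqrt N))"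
proof (rule bigoI[where c = 1], use eventually_ge_at_top[of 1] in eventually_elim)
  case (elim N)
  then have "sqrt N \<le> N" by (intro real_le_lsqrt self_le_power) auto
  with elim show ?case by (simp add: norm_divide frac_le)
qed

lemma inverse_bigo_1: "(\<lambda>N. of_real (1 / N) :: complex) \<in> O[at_top](\<lambda>_. 1)"
  using inverse_bigo_inverse_sqrt inverse_sqrt_bigo_1 by (rule landau_o.big_trans)

lemma expands_const: "expands (\<lambda>_. p) p 0"
  by (simp add: expands_def)

lemma expands_inverse_sqrt: "expands (\<lambda>N. of_real (1 / sqrt N)) 0 1"
  by (simp add: expands_def)

lemma expands_add:
  assumes "expands f p q" "expands g p' q'"
  shows "expands (\<lambda>N. f N + g N) (p + p') (q + q')"
proof -
  have "(\<lambda>N. (f N - (p + q * of_real (1 / sqrt N))) + (g N - (p' + q' * of_real (1 / sqrt N))))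
      \<in> O(\<lambda>N. of_real (1 / N))"
    using assms unfolding expands_def by (rule sum_in_bigo)
  then show ?thesis by (simp add: expands_def algebra_simps add_divide_distrib)
qed

lemma expands_linear_bigo_1: "(\<lambda>N. p + q * of_real (1 / sqrt N)) \<in> O[at_top](\<lambda>_. 1 :: complex)"
  by (intro sum_in_bigo landau_o.big.mult_in_1 inverse_sqrt_bigo_1 bigo_const)

lemma expands_bigo_1:
  assumes "expands f p q"
  shows "f \<in> O(\<lambda>_. 1)"
  using sum_in_bigo(1)[OF landau_o.big_trans[OF assms[unfolded expands_def] inverse_bigo_1]
      expands_linear_bigo_1[of p q]]
  by (simp only: diff_add_cancel)

text \<open>The error of the product splits into the linear part of \<open>f\<close> times the
  remainder of \<open>g\<close>, the remainder of \<open>f\<close> times \<open>g\<close>, and the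
  product of the two \<open>1 / sqrt N\<close> terms. The first two are a bounded function times
  O(1/N), the third is of order 1/N itself.\<close>

lemma expands_mult:
  assumes f: "expands f p q" and g: "expands g p' q'"
  shows "expands (\<lambda>N. f N * g N) (p * p') (p * q' + q * p')"
proof -
  let ?h = "\<lambda>N. of_real (1 / sqrt N) :: complex"
  let ?r = "\<lambda>N. f N - (p + q * ?h N)" and ?r' = "\<lambda>N. g N - (p' + q' * ?h N)"
  have "(\<lambda>N. (p + q * ?h N) * ?r' N) \<in> O(\<lambda>N. of_real (1 / N))"
    using landau_o.big.mult[OF expands_linear_bigo_1 g[unfolded expands_def]] by simp
  moreover have "(\<lambda>N. ?r N * g N) \<in> O(\<lambda>N. of_real (1 / N))"
    using landau_o.big.mult[OF f[unfolded expands_def] expands_bigo_1[OF g]] by simp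
  moreover have "(\<lambda>N. (q * ?h N) * (q' * ?h N)) \<in> O(\<lambda>N. of_real (1 / N))"
    by (intro bigo_inverse_sqrt_mult cmult_inverse_sqrt_bigo)
  ultimately have "(\<lambda>N. (p + q * ?h N) * ?r' N + ?r N * g N + (q * ?h N) * (q' * ?h N))
      \<in> O(\<lambda>N. of_real (1 / N))"
    by (intro sum_in_bigo)
  then show ?thesis unfolding expands_def
    by (rule back_subst[where P = "\<lambda>f. f \<in> _"]) (auto simp: algebra_simps)
qed

lemma expands_cmult:
  assumes "expands f p q"
  shows "expands (\<lambda>N. c * f N) (c * p) (c * q)"
  using expands_mult[OF expands_const[of c] assms] by simp

lemma expands_mult_inverse_sqrt:
  assumes "expands f p q"
  shows "expands (\<lambda>N. of_real (1 / sqrt N) * f N) 0 p"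
  using expands_mult[OF expands_inverse_sqrt assms] by simp

text \<open>Factor out \<open>exp p\<close>. The rest \<open>f N - p\<close> is O(1 / sqrt N), so
  the quadratic Taylor remainder of its exponential is O(1/N).\<close>

lemma expands_exp:
  assumes "expands f p q"
  shows "expands (\<lambda>N. exp (f N)) (exp p) (exp p * q)"
proof -
  let ?h = "\<lambda>N. of_real (1 / sqrt N) :: complex"
  let ?r = "\<lambda>N. f N - (p + q * ?h N)" and ?v = "\<lambda>N. f N - p"
  have r: "?r \<in> O(\<lambda>N. of_real (1 / N))" using assms by (simp add: expands_def)
  have "(\<lambda>N. ?r N + q * ?h N) \<in> O(?h)"
    using landau_o.big_trans[OF r inverse_bigo_inverse_sqrt] cmult_inverse_sqrt_bigo
    by (rule sum_in_bigo)
  then have v: "?v \<in> O(?h)" by simp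
  then have "?v \<in> O(\<lambda>_. 1)" using inverse_sqrt_bigo_1 by (rule landau_o.big_trans)
  \<comment> \<open>The bound on \<open>f N - p\<close> makes the factor
    \<open>exp \<bar>Re (?v N)\<bar>\<close> in the Taylor remainder at most the constant
    \<open>exp c\<close>.\<close>
  then obtain c where c: "eventually (\<lambda>N. norm (?v N) \<le> c) at_top"
    by (auto elim: landau_o.bigE)
  have "(\<lambda>N. exp (?v N) - (1 + ?v N)) \<in> O(\<lambda>N. ?v N * ?v N)"
  proof (rule bigoI[where c = "exp c"], use c in eventually_elim)
    case (elim N)
    have "norm (exp (?v N) - (1 + ?v N)) \<le> exp \<bar>Re (?v N)\<bar> * norm (?v N) ^ 2"
      using Taylor_exp[of "?v N" 1] by (simp add: numeral_2_eq_2)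
    also have "\<dots> \<le> exp c * norm (?v N) ^ 2"
      using elim abs_Re_le_cmod[of "?v N"] by (intro mult_right_mono) auto
    finally show ?case by (simp add: norm_mult power2_eq_square)
  qed
  also have "(\<lambda>N. ?v N * ?v N) \<in> O(\<lambda>N. of_real (1 / N))"
    using v v by (rule bigo_inverse_sqrt_mult)
  finally have "(\<lambda>N. (exp (?v N) - (1 + ?v N)) + ?r N) \<in> O(\<lambda>N. of_real (1 / N))"
    using r by (rule sum_in_bigo)
  then have "(\<lambda>N. exp p * ((exp (?v N) - (1 + ?v N)) + ?r N)) \<in> O(\<lambda>N. of_real (1 / N))"
    by (simp only: landau_o.big.cmult_in_iff[OF exp_not_eq_zero])
  moreover have "exp p * exp (f N - p) = exp (f N)" for N
    by (simp flip: exp_add)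
  ultimately show ?thesis unfolding expands_def
    by (simp add: algebra_simps)
qed

section \<open>Expansions of the elementary factors\<close>

text \<open>With \<open>w\<close> the square root and \<open>d = w - 1\<close>, the error equals
  \<open>d\<^sup>2 * (1 / w + 1 / 2)\<close>, as \<open>s\<close> can be expressed through
  \<open>w\<^sup>2\<close>. Here \<open>d\<close> is at most \<open>\<bar>s\<bar>\<close> and
  \<open>w\<close> at least 1 in norm.\<close>

lemma norm_inverse_csqrt_sub:
  "norm (1 / csqrt (1 - \<i> * of_real s) - (1 + \<i> * of_real (s / 2))) \<le> 3 / 2 * s\<^sup>2"
proof -
  define w where "w = csqrt (1 - \<i> * of_real s)"
  define d where "d = w - 1"
  have w2: "w\<^sup>2 = 1 - \<i> * of_real s" by (simp add: w_def)
  have "1 \<le> norm (w\<^sup>2)" unfolding w2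
    using abs_Re_le_cmod[of "1 - \<i> * of_real s"] by simp
  then have w1: "1 \<le> norm w" using power2_le_imp_le[of 1 "norm w"] by (simp add: norm_power)
  then have w0: "w \<noteq> 0" by auto
  \<comment> \<open>The choice of the principal branch enters here: it keeps \<open>w + 1\<close>
    away from 0, so that \<open>d * (w + 1) = - (\<i> * of_real s)\<close> bounds
    \<open>d\<close>.\<close>
  have "0 \<le> Re w" unfolding w_def using csqrt_principal[of "1 - \<i> * of_real s"] by auto
  then have "1 \<le> norm (w + 1)" using complex_Re_le_cmod[of "w + 1"] by simp
  moreover have "d * (w + 1) = - (\<i> * of_real s)"
    using w2 by (simp add: d_def algebra_simps power2_eq_square)
  then have "norm d * norm (w + 1) = \<bar>s\<bar>" 
    by (metis norm_mult norm_minus_cancel norm_ii norm_of_real mult_1)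
  ultimately have d: "norm d \<le> \<bar>s\<bar>" 
    using mult_left_mono[of 1 "norm (w + 1)" "norm d"] by simp
  have "1 / w - (1 + \<i> * of_real (s / 2)) = d\<^sup>2 * (1 / w + 1 / 2)"
  proof -
    have s: "\<i> * of_real (s / 2) = (1 - w\<^sup>2) / 2" using w2 by simp
    show ?thesis unfolding s d_def using w0 by (simp add: field_simps power2_eq_square)
  qed
  then have "norm (1 / w - (1 + \<i> * of_real (s / 2))) = (norm d)\<^sup>2 * norm (1 / w + 1 / 2)"
    by (simp add: norm_mult norm_power)
  moreover have "norm (1 / w + 1 / 2) \<le> 3 / 2"
  proof -
    have "norm (1 / w) \<le> 1"
      using le_imp_inverse_le[OF w1] by (simp add: norm_divide inverse_eq_divide)
    then show ?thesis using norm_triangle_ineq[of "1 / w" "1 / 2"] by simp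
  qed
  then have "(norm d)\<^sup>2 * norm (1 / w + 1 / 2) \<le> s\<^sup>2 * (3 / 2)"
    using d by (intro mult_mono) (auto simp: abs_le_square_iff[symmetric])
  ultimately show ?thesis by (simp add: w_def mult.commute)
qed

text \<open>The geometric series cut after the linear term has the exact remainder
  \<open>- s\<^sup>2 / (1 - \<i> * s)\<close>, whose denominator has norm at least 1.\<close>

lemma norm_inverse_sub:
  "norm (1 / (1 - \<i> * of_real s) - (1 + \<i> * of_real s)) \<le> s\<^sup>2"
proof -
  have n: "1 \<le> norm (1 - \<i> * of_real s)"
    using abs_Re_le_cmod[of "1 - \<i> * of_real s"] by simp
  then have "1 - \<i> * of_real s \<noteq> 0" by auto
  then have "1 / (1 - \<i> * of_real s) - (1 + \<i> * of_real s) = - of_real (s\<^sup>2) / (1 - \<i> * of_real s)"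
    by (simp add: divide_simps) (simp add: algebra_simps power2_eq_square)
  also have "norm \<dots> = s\<^sup>2 / norm (1 - \<i> * of_real s)"
    by (simp add: norm_divide norm_power)
  also have "\<dots> \<le> s\<^sup>2" using n by (simp add: divide_le_eq mult_le_cancel_left1)
  finally show ?thesis .
qed

lemma expands_inverse_csqrt:
  "expands (\<lambda>N. 1 / csqrt (1 - \<i> * of_real (B / sqrt N))) 1 (\<i> * of_real (B / 2))"
  unfolding expands_def
proof (rule bigoI[where c = "3 / 2 * B\<^sup>2"], use eventually_gt_at_top[of 0] in eventually_elim)
  case (elim N)
  then show ?case using norm_inverse_csqrt_sub[of "B / sqrt N"]
    by (simp add: norm_divide power_divide mult_ac)
qed

lemma expands_inverse:
  "expands (\<lambda>N. 1 / (1 - \<i> * of_real (B / sqrt N))) 1 (\<i> * of_real B)"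
  unfolding expands_def
proof (rule bigoI[where c = "B\<^sup>2"], use eventually_gt_at_top[of 0] in eventually_elim)
  case (elim N)
  then show ?case using norm_inverse_sub[of "B / sqrt N"]
    by (simp add: norm_divide power_divide mult_ac)
qed

text \<open>The argument is purely imaginary, so the growth factor
  \<open>exp \<bar>Re z\<bar>\<close> of \<open>Taylor_exp\<close> equals 1; the denominator
  \<open>fact n\<close> is inherited from that bound.\<close>

lemma norm_exp_ii_sub_taylor:
  "norm (exp (\<i> * of_real y) - (\<Sum>k\<le>n. (\<i> * of_real y) ^ k / fact k)) \<le> \<bar>y\<bar> ^ Suc n / fact n"
  using Taylor_exp[of "\<i> * of_real y" n] by (simp add: norm_mult norm_power)

text \<open>Taylor to second order: the prefactor \<open>sqrt N\<close> costs one power, leaving an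
  error of order \<open>\<bar>t\<bar> ^ 3 / N\<close>.\<close>

lemma expands_exp_ii_sub_1:
  "expands (\<lambda>N. of_real (sqrt N) * (exp (\<i> * of_real (t / sqrt N)) - 1))
     (\<i> * of_real t) (- of_real (t\<^sup>2 / 2))"
  unfolding expands_def
proof (rule bigoI[where c = "\<bar>t\<bar> ^ 3 / 2"], use eventually_gt_at_top[of 0] in eventually_elim)
  case (elim N)
  define h where "h = sqrt N"
  have h: "h > 0" "N = h\<^sup>2" using elim by (simp_all add: h_def)
  define u where "u = exp (\<i> * of_real (t / h))"
  have "of_real h * (u - 1) - (\<i> * of_real t + - of_real (t\<^sup>2 / 2) * of_real (1 / h))
      = of_real h * (u - (\<Sum>k\<le>2. (\<i> * of_real (t / h)) ^ k / fact k))"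
    using h by (simp add: numeral_2_eq_2 field_simps power2_eq_square)
  also have "norm \<dots> \<le> h * (\<bar>t / h\<bar> ^ 3 / 2)"
    unfolding norm_mult u_def
  proof (intro mult_mono)
    show "norm (exp (\<i> * of_real (t / h)) - (\<Sum>k\<le>2. (\<i> * of_real (t / h)) ^ k / fact k))
        \<le> \<bar>t / h\<bar> ^ 3 / 2"
      using norm_exp_ii_sub_taylor[of "t / h" 2] by (simp add: eval_nat_numeral)
  qed (use h in \<open>simp_all add: norm_power\<close>)
  also have "\<dots> = \<bar>t\<bar> ^ 3 / 2 * (1 / N)"
    using h by (simp add: field_simps power_divide power2_eq_square power3_eq_cube)
  finally show ?case using h by (simp add: u_def norm_divide norm_power h_def[symmetric])
qed

text \<open>This is the logarithm of the characteristic function at \<open>t\<close> of a Poisson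
  variable with mean \<open>N\<close>, centred and divided by \<open>sqrt N\<close>. It yields the
  Gaussian factor and the cubic correction. The prefactor \<open>N\<close> costs two powers, hence
  Taylor to third order.\<close>

lemma expands_exponent:
  "expands (\<lambda>N. of_real N * (exp (\<i> * of_real (t / sqrt N)) - 1 - \<i> * of_real (t / sqrt N)))
     (- of_real (t\<^sup>2 / 2)) (- \<i> * of_real (t ^ 3 / 6))"
  unfolding expands_def
proof (rule bigoI[where c = "\<bar>t\<bar> ^ 4 / 6"], use eventually_gt_at_top[of 0] in eventually_elim)
  case (elim N)
  define h where "h = sqrt N"
  have h: "h > 0" "N = h\<^sup>2" using elim by (simp_all add: h_def)
  define u where "u = exp (\<i> * of_real (t / h))"
  have "of_real N * (u - 1 - \<i> * of_real (t / h))
        - (- of_real (t\<^sup>2 / 2) + - \<i> * of_real (t ^ 3 / 6) * of_real (1 / h))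
      = of_real N * (u - (\<Sum>k\<le>3. (\<i> * of_real (t / h)) ^ k / fact k))"
    using h by (simp add: numeral_3_eq_3 field_simps power2_eq_square)
  also have "norm \<dots> \<le> N * (\<bar>t / h\<bar> ^ 4 / 6)"
    unfolding norm_mult u_def
  proof (intro mult_mono)
    show "norm (exp (\<i> * of_real (t / h)) - (\<Sum>k\<le>3. (\<i> * of_real (t / h)) ^ k / fact k))
        \<le> \<bar>t / h\<bar> ^ 4 / 6"
      using norm_exp_ii_sub_taylor[of "t / h" 3] by (simp add: eval_nat_numeral)
  qed (use h in \<open>simp_all add: norm_power\<close>)
  also have "\<dots> = \<bar>t\<bar> ^ 4 / 6 * (1 / N)"
    using h by (simp add: field_simps power_divide power2_eq_square power4_eq_xxxx)
  finally show ?case using h by (simp add: u_def norm_divide norm_power h_def[symmetric])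
qed

section \<open>Moments of the exponential series\<close>

text \<open>Cancelling \<open>n\<close> against \<open>fact n\<close> shifts the index by one.
  Expanding powers of \<open>Suc n\<close> then yields each moment from the lower ones.\<close>

lemma sums_of_nat_mult_exp:
  fixes w S :: "'a::{banach,real_normed_field}"
  assumes "(\<lambda>n. f (Suc n) * (w ^ n / fact n)) sums S"
  shows "(\<lambda>n. of_nat n * f n * (w ^ n / fact n)) sums (w * S)"
proof -
  have "(\<lambda>n. w * (f (Suc n) * (w ^ n / fact n))) sums (w * S)"
    using assms by (rule sums_mult)
  moreover have "w * (f (Suc n) * (w ^ n / fact n))
      = of_nat (Suc n) * f (Suc n) * (w ^ Suc n / fact (Suc n))" for n
    by (simp add: field_simps del: of_nat_Suc)
  ultimately have "(\<lambda>n. of_nat (Suc n) * f (Suc n) * (w ^ Suc n / fact (Suc n))) sums (w * S)"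
    by simp
  \<comment> \<open>The factor \<open>of_nat n\<close> kills the term at \<open>n = 0\<close>, so
    the unshifted series has the same sum.\<close>
  then show ?thesis
    using sums_Suc_iff[of "\<lambda>n. of_nat n * f n * (w ^ n / fact n)" "w * S"] by simp
qed

context
  fixes w :: "'a::{banach,real_normed_field}"
begin

lemma sums_exp_moment_0: "(\<lambda>n. w ^ n / fact n) sums exp w"
  using exp_converges[of w] by (simp add: scaleR_conv_of_real field_simps)

lemma sums_exp_moment_1: "(\<lambda>n. of_nat n * (w ^ n / fact n)) sums (w * exp w)"
  using sums_of_nat_mult_exp[of "\<lambda>_. 1" w "exp w"] sums_exp_moment_0 by simp

lemma sums_exp_moment_2: "(\<lambda>n. of_nat n ^ 2 * (w ^ n / fact n)) sums ((w\<^sup>2 + w) * exp w)"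
proof -
  have "(\<lambda>n. of_nat (Suc n) * (w ^ n / fact n)) sums (w * exp w + exp w)"
    using sums_add[OF sums_exp_moment_1 sums_exp_moment_0]
    by (simp add: algebra_simps add_divide_distrib)
  from sums_of_nat_mult_exp[OF this] show ?thesis
    by (simp add: algebra_simps power2_eq_square)
qed

lemma sums_exp_moment_3:
  "(\<lambda>n. of_nat n ^ 3 * (w ^ n / fact n)) sums ((w ^ 3 + 3 * w\<^sup>2 + w) * exp w)"
proof -
  have "(\<lambda>n. of_nat (Suc n) ^ 2 * (w ^ n / fact n))
      sums ((w\<^sup>2 + w) * exp w + 2 * (w * exp w) + exp w)"
    using sums_add[OF sums_add[OF sums_exp_moment_2 sums_mult[OF sums_exp_moment_1, of 2]]
        sums_exp_moment_0]
    by (simp add: algebra_simps power2_eq_square)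
  from sums_of_nat_mult_exp[of "\<lambda>n. of_nat n ^ 2", OF this] show ?thesis
    by (simp add: algebra_simps power2_eq_square power3_eq_cube)
qed

lemma sums_exp_moment_4:
  "(\<lambda>n. of_nat n ^ 4 * (w ^ n / fact n)) sums ((w ^ 4 + 6 * w ^ 3 + 7 * w\<^sup>2 + w) * exp w)"
proof -
  have "(\<lambda>n. of_nat (Suc n) ^ 3 * (w ^ n / fact n))
      sums ((w ^ 3 + 3 * w\<^sup>2 + w) * exp w + 3 * ((w\<^sup>2 + w) * exp w) + 3 * (w * exp w) + exp w)"
    using sums_add[OF sums_add[OF sums_add[OF sums_exp_moment_3
        sums_mult[OF sums_exp_moment_2, of 3]] sums_mult[OF sums_exp_moment_1, of 3]]
        sums_exp_moment_0]
    by (simp add: algebra_simps power2_eq_square power3_eq_cube)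
  from sums_of_nat_mult_exp[of "\<lambda>n. of_nat n ^ 3", OF this] show ?thesis
    by (simp add: algebra_simps power2_eq_square power3_eq_cube power4_eq_xxxx)
qed

text \<open>The centre \<open>c\<close> is kept apart from \<open>w\<close>: the sum needed later
  has \<open>w = N * u\<close> with \<open>u\<close> on the unit circle, but is centred at
  \<open>N\<close>.\<close>

lemma sums_exp_shifted_moment_2:
  "(\<lambda>n. (of_nat n - c) ^ 2 * (w ^ n / fact n)) sums (((w - c)\<^sup>2 + w) * exp w)"
  using sums_add[OF sums_diff[OF sums_exp_moment_2 sums_mult[OF sums_exp_moment_1, of "2 * c"]]
      sums_mult[OF sums_exp_moment_0, of "c ^ 2"]]
  by (simp add: algebra_simps power2_eq_square)

text \<open>Expand the fourth power binomially and insert the raw moments; the terms in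
  \<open>w ^ 4\<close> and \<open>w ^ 3\<close> cancel, so only order \<open>w\<^sup>2\<close>
  remains.\<close>

lemma sums_exp_centered_moment_4:
  "(\<lambda>n. (of_nat n - w) ^ 4 * (w ^ n / fact n)) sums ((3 * w\<^sup>2 + w) * exp w)"
proof -
  have "(\<lambda>n. of_nat n ^ 4 * (w ^ n / fact n) - 4 * w * (of_nat n ^ 3 * (w ^ n / fact n))
        + 6 * w\<^sup>2 * (of_nat n ^ 2 * (w ^ n / fact n)) - 4 * w ^ 3 * (of_nat n * (w ^ n / fact n))
        + w ^ 4 * (w ^ n / fact n))
      sums ((w ^ 4 + 6 * w ^ 3 + 7 * w\<^sup>2 + w) * exp w
        - 4 * w * ((w ^ 3 + 3 * w\<^sup>2 + w) * exp w)
        + 6 * w\<^sup>2 * ((w\<^sup>2 + w) * exp w) - 4 * w ^ 3 * (w * exp w) + w ^ 4 * exp w)"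
    by (intro sums_add sums_diff sums_mult sums_exp_moment_0 sums_exp_moment_1 sums_exp_moment_2
        sums_exp_moment_3 sums_exp_moment_4)
  moreover have "of_nat n ^ 4 * q - 4 * w * (of_nat n ^ 3 * q) + 6 * w\<^sup>2 * (of_nat n ^ 2 * q)
      - 4 * w ^ 3 * (of_nat n * q) + w ^ 4 * q = (of_nat n - w) ^ 4 * q" for n q
    by (simp add: algebra_simps power2_eq_square power3_eq_cube power4_eq_xxxx)
  moreover have "(w ^ 4 + 6 * w ^ 3 + 7 * w\<^sup>2 + w) * e
        - 4 * w * ((w ^ 3 + 3 * w\<^sup>2 + w) * e)
        + 6 * w\<^sup>2 * ((w\<^sup>2 + w) * e) - 4 * w ^ 3 * (w * e) + w ^ 4 * e
      = (3 * w\<^sup>2 + w) * e" for e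
    by (simp add: algebra_simps power2_eq_square power3_eq_cube power4_eq_xxxx)
  ultimately show ?thesis by (simp only:)
qed

end

section \<open>Linearising the quadratic phase in the Poisson sum\<close>

text \<open>
  Closed form of the Poisson sum with \<open>exp (\<i> * s * x\<^sup>2 / 2)\<close> linearised, up to the unimodular factor
  \<open>exp (\<i> * sqrt N * (A + B / 2))\<close>.
\<close>

definition Z_main :: "real \<Rightarrow> real \<Rightarrow> real \<Rightarrow> complex" where
  "Z_main t B N = (let u = exp (\<i> * of_real (t / sqrt N)) in
     exp (of_real N * (u - 1 - \<i> * of_real (t / sqrt N))) *
     (1 + \<i> * of_real (B / 2) * (of_real (1 / sqrt N) *
       ((of_real (sqrt N) * (u - 1)) * (of_real (sqrt N) * (u - 1)) + u))))"

text \<open>Termwise, linearisation costs at most \<open>s\<^sup>2 / 4\<close> times the Poisson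
  weight times \<open>x ^ 4\<close>. The fourth moment of \<open>x\<close> is
  \<open>3 + 1 / N\<close>, at most 4, and \<open>s\<^sup>2 = B\<^sup>2 / N\<close>.\<close>

lemma norm_Z_sub_Z_main:
  assumes N: "N \<ge> 1"
  shows "norm (Z A B N - exp (\<i> * of_real (sqrt N * (A + B / 2))) * Z_main (A + B) B N) \<le> B\<^sup>2 / N"
proof -
  define h where "h = sqrt N"
  have h: "h > 0" "N = h\<^sup>2" using N by (simp_all add: h_def)
  define t where "t = A + B"
  define s where "s = B / h"
  define u where "u = exp (\<i> * of_real (t / h))"
  define w where "w = of_real N * u"
  define x where "x n = (real n - N) / h" for n
  define p where "p n = exp (- N) * (N ^ n / fact n)" for n
  \<comment> \<open>\<open>a\<close> holds the exact terms and \<open>b\<close> the linearised ones,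
    both without the common factor \<open>E\<close>.\<close>
  define a where "a n = of_real (p n) * exp (\<i> * of_real (t * x n + s * (x n)\<^sup>2 / 2))" for n
  define b where
    "b n = of_real (p n) * (exp (\<i> * of_real (t * x n)) * (1 + \<i> * of_real (s * (x n)\<^sup>2 / 2)))" for n
  define E where "E = exp (\<i> * of_real (h * (A + B / 2)))"
  have p0: "p n \<ge> 0" for n using N by (simp add: p_def)

  have ab: "norm (a n - b n) \<le> s\<^sup>2 / 4 * (p n * x n ^ 4)" for n
  proof -
    let ?y = "s * (x n)\<^sup>2 / 2"
    have "a n - b n = of_real (p n) * (exp (\<i> * of_real (t * x n)) *
        (exp (\<i> * of_real ?y) - (1 + \<i> * of_real ?y)))"
      by (simp add: a_def b_def exp_add ring_distribs)
    then have "norm (a n - b n) = p n * norm (exp (\<i> * of_real ?y) - (1 + \<i> * of_real ?y))"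
      using p0[of n] by (simp only: norm_mult norm_exp_i_times norm_of_real)
    \<comment> \<open>The first-order Taylor bound is the plain square
      \<open>\<bar>?y\<bar>\<^sup>2\<close>, as \<open>fact 1 = 1\<close>; the 1/4 comes from the
      1/2 inside \<open>?y\<close>.\<close>
    also have "\<dots> \<le> p n * \<bar>?y\<bar>\<^sup>2"
      using norm_exp_ii_sub_taylor[of ?y 1] p0[of n]
      by (intro mult_left_mono) (simp_all add: numeral_2_eq_2)
    also have "\<dots> = s\<^sup>2 / 4 * (p n * x n ^ 4)"
      by (simp add: power2_eq_square power4_eq_xxxx)
    finally show ?thesis .
  qed

  have "(\<lambda>n. exp (- N) / h ^ 4 * ((real n - N) ^ 4 * (N ^ n / fact n)))
      sums (exp (- N) / h ^ 4 * ((3 * N\<^sup>2 + N) * exp N))"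
    by (intro sums_mult sums_exp_centered_moment_4)
  moreover have "exp (- N) / h ^ 4 * ((3 * N\<^sup>2 + N) * exp N) = 3 + 1 / N"
    using h by (simp add: exp_minus field_simps power2_eq_square power4_eq_xxxx)
  ultimately have p4: "(\<lambda>n. p n * x n ^ 4) sums (3 + 1 / N)"
    by (simp add: p_def x_def power_divide mult_ac)

  \<comment> \<open>Since \<open>t * x n = n * (t / h) - t * h\<close>, the phase turns
    \<open>N ^ n\<close> into \<open>w ^ n\<close>, and \<open>K\<close> collects everything
    independent of \<open>n\<close>. The sum of \<open>b\<close> thus reduces to the zeroth and the
    shifted second moment at \<open>w\<close>.\<close>
  define K where "K = exp (- of_real N - \<i> * of_real (t * h))"
  have "(\<lambda>n. K * (w ^ n / fact n) + K * (\<i> * of_real (s / (2 * N))) *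
        ((of_nat n - of_real N)\<^sup>2 * (w ^ n / fact n)))
      sums (K * exp w + K * (\<i> * of_real (s / (2 * N))) * (((w - of_real N)\<^sup>2 + w) * exp w))"
    by (intro sums_add sums_mult sums_exp_moment_0 sums_exp_shifted_moment_2)
  moreover have "K * (w ^ n / fact n) + K * (\<i> * of_real (s / (2 * N))) *
        ((of_nat n - of_real N)\<^sup>2 * (w ^ n / fact n)) = b n" for n
  proof -
    have "t * x n = real n * (t / h) - t * h"
      using h by (simp add: x_def field_simps power2_eq_square)
    then have "\<i> * of_real (t * x n) = of_nat n * (\<i> * of_real (t / h)) + - (\<i> * of_real (t * h))"
      by (simp only:) (simp add: algebra_simps)
    then have "exp (\<i> * of_real (t * x n)) = u ^ n * exp (- (\<i> * of_real (t * h)))"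
      by (simp only: u_def exp_add exp_of_nat_mult)
    moreover have "K = of_real (exp (- N)) * exp (- (\<i> * of_real (t * h)))"
      by (simp add: K_def mult_exp_exp flip: exp_of_real)
    ultimately have "b n = K * (w ^ n / fact n) * (1 + \<i> * of_real (s * (x n)\<^sup>2 / 2))"
      by (simp add: b_def p_def w_def power_mult_distrib mult_ac)
    also have "s * (x n)\<^sup>2 / 2 = s / (2 * N) * (real n - N)\<^sup>2"
      using h by (simp add: x_def power_divide)
    finally show ?thesis by (simp add: algebra_simps)
  qed
  moreover have "K * exp w + K * (\<i> * of_real (s / (2 * N))) * (((w - of_real N)\<^sup>2 + w) * exp w)
      = Z_main t B N"
  proof -
    have e1: "exp (of_real N * (u - 1 - \<i> * of_real (t / h))) = K * exp w"
      using h unfolding K_def w_def exp_add[symmetric]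
      by (intro arg_cong[where f = exp]) (simp add: field_simps power2_eq_square)
    have e2: "\<i> * of_real (B / 2) *
          (of_real (1 / h) * ((of_real h * (u - 1)) * (of_real h * (u - 1)) + u))
        = \<i> * of_real (s / (2 * N)) * ((w - of_real N)\<^sup>2 + w)"
      using h by (simp add: s_def w_def field_simps power2_eq_square)
    have "Z_main t B N = K * exp w * (1 + \<i> * of_real (s / (2 * N)) * ((w - of_real N)\<^sup>2 + w))"
      unfolding Z_main_def Let_def h_def[symmetric] u_def[symmetric] e1 e2 ..
    then show ?thesis by (simp only: ring_distribs mult_1_left mult_1_right mult_ac)
  qed
  ultimately have b: "b sums Z_main t B N" by (simp only:)

  have dom: "summable (\<lambda>n. s\<^sup>2 / 4 * (p n * x n ^ 4))"
    using p4 by (intro summable_mult) (rule sums_summable)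
  have sd: "summable (\<lambda>n. a n - b n)"
    using ab by (intro summable_comparison_test'[OF dom, of 0])
  \<comment> \<open>Write \<open>a\<close> as \<open>(a - b) + b\<close>: the difference is
    dominated by the fourth-moment series, and \<open>b\<close> has a known sum.\<close>
  have sa: "summable a"
    using summable_add[OF sd sums_summable[OF b]] by simp
  have "Z A B N = (\<Sum>n. E * a n)"
  proof -
    have "exp (- of_real N) * (of_real (N ^ n / fact n) *
        exp (\<i> * of_real (A * real n / sqrt N + B * (real n)\<^sup>2 / (2 * sqrt (N ^ 3))))) = E * a n" for n
    proof -
      have "sqrt (N ^ 3) = h ^ 3" by (simp add: h_def real_sqrt_power)
      \<comment> \<open>Substitute \<open>n = h\<^sup>2 + h * x n\<close>; the cross term of the
        square adds \<open>B\<close> to the coefficient \<open>A\<close> of \<open>x n\<close>,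
        whence \<open>t = A + B\<close>.\<close>
      moreover have "A * real n / h + B * (real n)\<^sup>2 / (2 * h ^ 3)
          = h * (A + B / 2) + (t * x n + s * (x n)\<^sup>2 / 2)"
        using h(1) unfolding x_def s_def t_def h(2)
        by (simp add: field_simps power2_eq_square power3_eq_cube)
      ultimately have "exp (\<i> * of_real (A * real n / sqrt N + B * (real n)\<^sup>2 / (2 * sqrt (N ^ 3))))
          = E * exp (\<i> * of_real (t * x n + s * (x n)\<^sup>2 / 2))"
        unfolding E_def exp_add[symmetric] h_def[symmetric] by (simp only: of_real_add ring_distribs)
      then show ?thesis by (simp add: a_def p_def exp_of_real[symmetric] mult_ac)
    qed
    moreover have "summable (\<lambda>n. E * a n)" using sa by (rule summable_mult)
    ultimately have "(\<lambda>n. exp (- of_real N) * (of_real (N ^ n / fact n) *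
        exp (\<i> * of_real (A * real n / sqrt N + B * (real n)\<^sup>2 / (2 * sqrt (N ^ 3))))))
        sums (\<Sum>n. E * a n)" by (simp only: summable_sums)
    \<comment> \<open>In \<open>Z\<close> the factor \<open>exp (- of_real N)\<close> stands outside
      the series, so it is divided out.\<close>
    then have "(\<lambda>n. of_real (N ^ n / fact n) *
        exp (\<i> * of_real (A * real n / sqrt N + B * (real n)\<^sup>2 / (2 * sqrt (N ^ 3)))))
        sums ((\<Sum>n. E * a n) / exp (- of_real N))"
      by (rule sums_mult_D) simp
    then show ?thesis by (simp add: Z_def sums_iff)
  qed
  also have "\<dots> = E * suminf a" using sa by (rule suminf_mult)
  finally have "Z A B N - E * Z_main t B N = E * (\<Sum>n. a n - b n)"
    using suminf_diff[OF sa sums_summable[OF b]] sums_unique[OF b]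
    by (simp flip: right_diff_distrib)
  moreover have "norm E = 1" by (simp only: E_def norm_exp_i_times)
  ultimately have "norm (Z A B N - E * Z_main t B N) = norm (\<Sum>n. a n - b n)"
    by (simp only: norm_mult mult_1_left)
  also have "\<dots> \<le> (\<Sum>n. s\<^sup>2 / 4 * (p n * x n ^ 4))"
    by (rule norm_suminf_le[OF ab dom])
  also have "\<dots> = s\<^sup>2 / 4 * (3 + 1 / N)"
    using sums_mult[OF p4, of "s\<^sup>2 / 4"] by (simp add: sums_iff)
  also have "\<dots> \<le> s\<^sup>2 / 4 * 4"
    using N by (intro mult_left_mono) auto
  also have "\<dots> = B\<^sup>2 / N"
    using h by (simp add: s_def power_divide)
  finally show ?thesis unfolding E_def t_def h_def .
qed

section \<open>Matching the two expansions\<close>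

lemma expands_exp_ii: "expands (\<lambda>N. exp (\<i> * of_real (t / sqrt N))) 1 (\<i> * of_real t)"
  using expands_exp[OF expands_cmult[OF expands_inverse_sqrt, of "\<i> * of_real t"]] by simp

text \<open>In the correction, \<open>sqrt N * (u - 1)\<close> tends to \<open>\<i> * t\<close> and
  \<open>u\<close> to 1, which gives \<open>1 - t\<^sup>2\<close>; the cubic term comes from the
  exponent.\<close>

lemma expands_Z_main:
  "expands (Z_main t B) (exp (- of_real (t\<^sup>2 / 2)))
     (exp (- of_real (t\<^sup>2 / 2)) * (\<i> * of_real (B / 2 * (1 - t\<^sup>2) - t ^ 3 / 6)))"
proof -
  let ?u = "\<lambda>N. exp (\<i> * of_real (t / sqrt N))"
  have "expands (\<lambda>N. of_real (1 / sqrt N) *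
       ((of_real (sqrt N) * (?u N - 1)) * (of_real (sqrt N) * (?u N - 1)) + ?u N))
     0 (\<i> * of_real t * (\<i> * of_real t) + 1)"
    by (rule expands_mult_inverse_sqrt,
        rule expands_add[OF expands_mult[OF expands_exp_ii_sub_1 expands_exp_ii_sub_1]
          expands_exp_ii])
  \<comment> \<open>The coefficients appear exactly as the composition rules build them, so that the
    rules unify; they are simplified afterwards.\<close>
  then have "expands (Z_main t B)
     (exp (- of_real (t\<^sup>2 / 2)) * (1 + \<i> * of_real (B / 2) * 0))
     (exp (- of_real (t\<^sup>2 / 2)) * (0 + \<i> * of_real (B / 2) * (\<i> * of_real t * (\<i> * of_real t) + 1)) +
      exp (- of_real (t\<^sup>2 / 2)) * (- \<i> * of_real (t ^ 3 / 6)) * (1 + \<i> * of_real (B / 2) * 0))"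
    unfolding Z_main_def Let_def
    by (intro expands_mult expands_exp expands_exponent expands_add expands_const expands_cmult)
  then show ?thesis
    by (rule back_subst[where P = "\<lambda>q. expands _ _ q", THEN back_subst[where P = "\<lambda>p. expands _ p _"]])
      (simp_all add: algebra_simps power2_eq_square)
qed

text \<open>The inverse root contributes \<open>B / 2\<close> and the Gaussian exponent
  \<open>- B * t\<^sup>2 / 2\<close>, together the same \<open>B / 2 * (1 - t\<^sup>2)\<close> as in
  \<open>expands_Z_main\<close>. Both lemmas state their coefficients in the same form so that these
  cancel on subtraction.\<close>

lemma expands_Z_approx_factor:
  "expands (\<lambda>N. 1 / csqrt (1 - \<i> * of_real (B / sqrt N)) *
       exp (- of_real (t\<^sup>2 / 2) * (1 / (1 - \<i> * of_real (B / sqrt N)))) *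
       (1 + - \<i> * of_real (t ^ 3 / 6) * of_real (1 / sqrt N)))
     (exp (- of_real (t\<^sup>2 / 2)))
     (exp (- of_real (t\<^sup>2 / 2)) * (\<i> * of_real (B / 2 * (1 - t\<^sup>2) - t ^ 3 / 6)))"
proof -
  let ?e = "exp (- of_real (t\<^sup>2 / 2) * 1) :: complex"
  have "expands (\<lambda>N. 1 / csqrt (1 - \<i> * of_real (B / sqrt N)) *
       exp (- of_real (t\<^sup>2 / 2) * (1 / (1 - \<i> * of_real (B / sqrt N)))) *
       (1 + - \<i> * of_real (t ^ 3 / 6) * of_real (1 / sqrt N)))
     (1 * ?e * (1 + - \<i> * of_real (t ^ 3 / 6) * 0))
     (1 * ?e * (0 + - \<i> * of_real (t ^ 3 / 6) * 1) +
      (1 * (?e * (- of_real (t\<^sup>2 / 2) * (\<i> * of_real B))) + \<i> * of_real (B / 2) * ?e) *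
        (1 + - \<i> * of_real (t ^ 3 / 6) * 0))"
    by (intro expands_mult expands_exp expands_inverse_csqrt expands_add expands_const
        expands_cmult expands_inverse expands_inverse_sqrt)
  then show ?thesis
    by (rule back_subst[where P = "\<lambda>q. expands _ _ q", THEN back_subst[where P = "\<lambda>p. expands _ p _"]])
      (simp_all add: algebra_simps power2_eq_square)
qed

section \<open>Conclusion\<close>

lemma big_O_mod_log_of_bigo:
  assumes "E \<in> O[at_top](\<lambda>N. of_real (1 / N))"
  shows "big_O_mod_log E (\<lambda>N. 1 / N)"
proof -
  from assms obtain c where c: "c > 0"
    and ev: "eventually (\<lambda>N. norm (E N) \<le> c * norm (of_real (1 / N) :: complex)) at_top"
    by (rule landau_o.bigE)
  from eventually_conj[OF ev eventually_gt_at_top[of 0]] obtain N0 where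
    N0: "\<And>N. N \<ge> N0 \<Longrightarrow> norm (E N) \<le> c * norm (of_real (1 / N) :: complex) \<and> N > 0"
    unfolding eventually_at_top_linorder by blast
  \<comment> \<open>The witnesses are the exponent 0 and the threshold \<open>max N0 1\<close>,
    which is positive as required.\<close>
  have "\<forall>N\<ge>max N0 1. norm (E N) \<le> c * ln N ^ 0 * (1 / N)"
  proof (intro allI impI)
    fix N :: real assume "N \<ge> max N0 1"
    with N0[of N] show "norm (E N) \<le> c * ln N ^ 0 * (1 / N)" by (simp add: norm_divide)
  qed
  moreover have "max N0 1 > 0" by simp
  ultimately show ?thesis using c unfolding big_O_mod_log_def by blast
qed

theorem theorem3p1:
  fixes A B :: real
  shows "big_O_mod_log (\<lambda>N. Z A B N - Z_approx A B N) (\<lambda>N. 1 / N)"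
proof -
  define t where "t = A + B"
  \<comment> \<open>The phase of \<open>E\<close> grows with \<open>sqrt N\<close> in general, so
    \<open>E\<close> is kept out of the expansions; only its norm 1 is used.\<close>
  define E where "E N = exp (\<i> * of_real (sqrt N * (A + B / 2)))" for N
  define F where "F N = 1 / csqrt (1 - \<i> * of_real (B / sqrt N)) *
       exp (- of_real (t\<^sup>2 / 2) * (1 / (1 - \<i> * of_real (B / sqrt N)))) *
       (1 + - \<i> * of_real (t ^ 3 / 6) * of_real (1 / sqrt N))" for N
  have approx: "Z_approx A B N = E N * F N" for N
    unfolding Z_approx_def F_def E_def t_def by (simp add: mult.assoc)
  have "(\<lambda>N. Z A B N - E N * Z_main t B N) \<in> O(\<lambda>N. of_real (1 / N))"
    by (rule bigoI[where c = "B\<^sup>2"], use eventually_ge_at_top[of 1] in eventually_elim)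
      (use norm_Z_sub_Z_main in \<open>simp add: E_def t_def norm_divide\<close>)
  moreover have "(\<lambda>N. E N * (Z_main t B N - F N)) \<in> O(\<lambda>N. of_real (1 / N))"
  proof -
    have "E \<in> O(\<lambda>_. 1)"
      by (rule bigoI[where c = 1]) (simp add: E_def)
    \<comment> \<open>The two expansions have identical coefficients, so subtracting them leaves
      only the O(1/N) remainders.\<close>
    moreover have "(\<lambda>N. Z_main t B N - F N) \<in> O(\<lambda>N. of_real (1 / N))"
      using sum_in_bigo(2)[OF expands_Z_main[unfolded expands_def]
          expands_Z_approx_factor[unfolded expands_def], of t B B t]
      by (simp add: F_def)
    ultimately show ?thesis using landau_o.big.mult by fastforce
  qed
  ultimately have "(\<lambda>N. (Z A B N - E N * Z_main t B N) + E N * (Z_main t B N - F N))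
      \<in> O(\<lambda>N. of_real (1 / N))"
    by (rule sum_in_bigo)
  then have "(\<lambda>N. Z A B N - Z_approx A B N) \<in> O(\<lambda>N. of_real (1 / N))"
    by (simp add: approx ring_distribs)
  then show ?thesis by (rule big_O_mod_log_of_bigo)
qed

end
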